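(* Let $\mathcal{K}\subset\mathbb{R}^N$ be a convex body and suppose that the set of its incenters $\mathcal{M}(\mathcal{K})$ has dimension $k\in\{1,\dots,N-1\}$. Then the center of mass of $\mathcal{M}(\mathcal{K})$, defined by $$I_{\mathcal{M}}=\frac{\int_{\mathcal{M}(\mathcal{K})} y\,d\mathcal{H}^k(y)}{\mathcal{H}^k(\mathcal{M}(\mathcal{K}))},$$ belongs to the heart $\heartsuit(\mathcal{K})$. Here $\mathcal{H}^k$ denotes the standard $k$-dimensional Hausdorff measure.
   Context: A convex body in $\mathbb{R}^N$ is a compact convex set with non-empty interior. The inradius $r_{\mathcal{K}}$ is the radius of the largest balls contained in $\mathcal{K}$, and $\mathcal{M}(\mathcal{K})=\{x\in\mathcal{K}:\mathrm{dist}(x,\partial\mathcal{K})=r_{\mathcal{K}}\}$ (a convex set; its dimension is the dimension of its affine hull). For $\omega\in\mathbb{S}^{N-1}$ (the unit sphere) and $\lambda\in\mathbb{R}$, $T_{\lambda,\omega}$ is the reflection of $\mathbb{R}^N$ in the hyperplane $\{x:\langle x,\omega\rangle=\lambda\}$, and $\mathcal{K}_{\lambda,\omega}=\{x\in\mathcal{K}:\langle x,\omega\rangle\ge\lambda\}$. The maximal folding function is $\mathcal{R}_{\mathcal{K}}(\omega)=\min\{\lambda\in\mathbb{R}: T_{\lambda,\omega}(\mathcal{K}_{\lambda,\omega})\subseteq\mathcal{K}\}$. The heart of $\mathcal{K}$ is $\heartsuit(\mathcal{K})=\{x\in\mathcal{K}:\langle x,\omega\rangle\le\mathcal{R}_{\mathcal{K}}(\omega)\text{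 for every }\omega\in\mathbb{S}^{N-1}\}$. *)

theory Defs
  imports "HOL-Analysis.Analysis"
begin

section \<open>Hausdorff measure\<close>

text \<open>
  Weight of a covering set, normalised so that the \<open>k\<close>-dimensional Hausdorff measure agrees with
  Lebesgue measure on \<open>k\<close>-dimensional Euclidean space. The empty set is treated separately
  because \<open>0 ^ 0 = 1\<close>. Only bounded sets may be used: \<open>diameter\<close> is not meaningful on unbounded
  ones.
\<close>

definition hausdorff_weight :: "nat \<Rightarrow> 'a::metric_space set \<Rightarrow> ennreal" where
  "hausdorff_weight k U =
     (if U = {} then 0 else ennreal (unit_ball_vol (real k) * (diameter U / 2) ^ k))"

definition hausdorff_premeasure :: "nat \<Rightarrow> real \<Rightarrow> 'a::metric_space set \<Rightarrow> ennreal" where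
  "hausdorff_premeasure k \<delta> A =
     (INF C \<in> {C :: nat \<Rightarrow> 'a set. A \<subseteq> (\<Union>i. C i) \<and> (\<forall>i. bounded (C i) \<and> diameter (C i) \<le> \<delta>)}.
        \<Sum>i. hausdorff_weight k (C i))"

definition hausdorff_outer_measure :: "nat \<Rightarrow> 'a::metric_space set \<Rightarrow> ennreal" where
  "hausdorff_outer_measure k A = (SUP \<delta> \<in> {0<..}. hausdorff_premeasure k \<delta> A)"

text \<open>
  \<open>hausdorff_outer_measure k\<close> is a metric outer measure, hence countably additive on the Borel
  sets, so \<open>measure_of\<close> does not fall back to the zero measure here.
\<close>

definition hausdorff_measure :: "nat \<Rightarrow> 'a::metric_space measure" where
  "hausdorff_measure k = measure_of UNIV (sets borel) (hausdorff_outer_measure k)"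

definition hausdorff_center_of_mass :: "nat \<Rightarrow> 'a::euclidean_space set \<Rightarrow> 'a" where
  "hausdorff_center_of_mass k A =
     (LINT y:A|hausdorff_measure k. y) /\<^sub>R measure (hausdorff_measure k) A"


section \<open>Convex bodies, incenters and the heart\<close>

definition convex_body :: "'a::euclidean_space set \<Rightarrow> bool" where
  "convex_body K \<longleftrightarrow> compact K \<and> convex K \<and> interior K \<noteq> {}"

definition inradius :: "'a::euclidean_space set \<Rightarrow> real" where
  "inradius K = (GREATEST r. 0 < r \<and> (\<exists>x. cball x r \<subseteq> K))"

definition incenters :: "'a::euclidean_space set \<Rightarrow> 'a set" where
  "incenters K = {x \<in> K. infdist x (frontier K) = inradius K}"

text \<open>Reflection in the hyperplane \<open>{x. x \<bullet> \<omega> = l}\<close>; the formula presupposes \<open>norm \<omega> = 1\<close>.\<close>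

definition hyperplane_reflection :: "real \<Rightarrow> 'a::euclidean_space \<Rightarrow> 'a \<Rightarrow> 'a" where
  "hyperplane_reflection l \<omega> x = x - (2 * (x \<bullet> \<omega> - l)) *\<^sub>R \<omega>"

definition upper_cap :: "'a::euclidean_space set \<Rightarrow> real \<Rightarrow> 'a \<Rightarrow> 'a set" where
  "upper_cap K l \<omega> = {x \<in> K. x \<bullet> \<omega> \<ge> l}"

definition maximal_folding :: "'a::euclidean_space set \<Rightarrow> 'a \<Rightarrow> real" where
  "maximal_folding K \<omega> = (LEAST l. hyperplane_reflection l \<omega> ` upper_cap K l \<omega> \<subseteq> K)"

definition heart :: "'a::euclidean_space set \<Rightarrow> 'a set" where
  "heart K = {x \<in> K. \<forall>\<omega> \<in> sphere 0 1. x \<bullet> \<omega> \<le> maximal_folding K \<omega>}"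

end

theory Submission
  imports Defs
begin

text \<open>
  Write \<open>M\<close> for the set of incenters and \<open>r\<close> for the inradius. A point lies in \<open>M\<close> exactly when the
  closed ball of radius \<open>r\<close> around it lies in \<open>K\<close> (\<open>incenters_eq\<close>), so \<open>M\<close> is the intersection of
  the translates \<open>K - w\<close> with \<open>norm w \<le> r\<close>, and is compact and convex.

  Let \<open>T\<close> be the reflection in a hyperplane of normal \<open>\<omega>\<close> and level \<open>l\<close> that folds the upper cap of
  \<open>K\<close> into \<open>K\<close>. Then it folds the upper cap of \<open>M\<close> into \<open>M\<close> (\<open>incenters_folding\<close>). Indeed, if \<open>x\<close> is
  an incenter above the hyperplane, a point of the ball around \<open>T x\<close> is either above the hyperplane,
  hence no farther from \<open>x\<close> than from \<open>T x\<close>, or below it, hence the mirror image of a point of the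
  upper cap of the ball around \<open>x\<close>.

  A set that can be folded in this way has at least as much mass below the hyperplane as above it: its
  upper part reappears, reflected, inside its lower part. As the Hausdorff measure is invariant under
  \<open>T\<close>, the first moment of \<open>M\<close> about the hyperplane is not positive, so the center of mass is not
  above it (\<open>center_of_mass_le_of_folding\<close>). The least level at which folding is possible is
  attained (\<open>folding_maximal_folding\<close>), so all this applies to \<open>l = maximal_folding K \<omega>\<close>.

  The argument needs the Hausdorff measure to be a genuine measure on the Borel sets, by
  Caratheodory's criterion for metric outer measures (\<open>closed_in_lambda_system\<close>), and needs
  \<open>M\<close> to have finite positive measure in its own dimension (\<open>hausdorff_outer_measure_finite\<close> and
  \<open>hausdorff_outer_measure_pos\<close>); otherwise the quotient defining the center of mass would
  be a default value.
\<close>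

section \<open>Caratheodory's criterion for metric outer measures\<close>

text \<open>
  The difficulty is that \<open>E - F\<close> may approach \<open>F\<close>, so that the two parts of a test set \<open>E\<close> are not
  separated. Let \<open>D n\<close> be the part of \<open>E\<close> at distance at least \<open>1 / n\<close> from \<open>F\<close>; the hypothesis
  applies to \<open>E \<inter> F\<close> and \<open>D n\<close>. What is missing, \<open>E - F - D n\<close>, is a union of thin layers \<open>R j\<close>.
  Layers whose indices have the same parity are separated from each other, so the sum of the
  measures of all the layers is at most \<open>2 * \<mu> E\<close>, and when this is finite the missing part is
  negligible in the limit.
\<close>
lemma closed_in_lambda_system:
  fixes \<mu> :: "'a::metric_space set \<Rightarrow> ennreal"
  assumes outer: "outer_measure_space UNIV \<mu>"
    and metric: "\<And>A B e. 0 < e \<Longrightarrow> (\<And>x y. x \<in> A \<Longrightarrow> y \<in> B \<Longrightarrow> e \<le> dist x y) \<Longrightarrow> \<mu> A + \<mu> B \<le> \<mu> (A \<union> B)"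
    and "closed F"
  shows "F \<in> lambda_system UNIV UNIV \<mu>"
proof (cases "F = {}")
  case True
  have "positive UNIV \<mu>" using outer by (simp add: outer_measure_space_def)
  then show ?thesis using algebra.lambda_system_empty[OF algebra_Pow, of UNIV \<mu>] True by simp
next
  case F: False
  have mono: "\<mu> A \<le> \<mu> B" if "A \<subseteq> B" for A B
    using outer that by (simp add: outer_measure_space_def increasing_def)
  have csa: "countably_subadditive (Pow UNIV) \<mu>" and pos: "positive (Pow UNIV) \<mu>"
    using outer by (simp_all add: outer_measure_space_def)
  have sa: "\<mu> (A \<union> B) \<le> \<mu> A + \<mu> B" for A B
  proof -
    interpret ring_of_sets UNIV "Pow UNIV" by (rule ring_of_sets_Pow)
    have "\<mu> (A \<union> B) \<le> \<mu> A + \<mu> (B - A)"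
      using subadditiveD[OF countably_subadditive_subadditive[OF pos csa], of A "B - A"] by auto
    also have "\<dots> \<le> \<mu> A + \<mu> B" by (intro add_left_mono mono) auto
    finally show ?thesis .
  qed
  have "\<mu> (E \<inter> F) + \<mu> (E - F) \<le> \<mu> E" for E
  proof (cases "\<mu> E = \<infinity>")
    case True
    then show ?thesis by simp
  next
    case False
    define D where "D n = {x \<in> E. 1 \<le> real n * infdist x F}" for n
    define R where "R j = D (j + 2) - D (j + 1)" for j
    have D_mono: "D m \<subseteq> D n" if "m \<le> n" for m n
    proof
      fix x assume "x \<in> D m"
      moreover have "real m * infdist x F \<le> real n * infdist x F"
        using that by (intro mult_right_mono infdist_nonneg) simp
      ultimately show "x \<in> D n" by (simp add: D_def)
    qed
    have D_E: "D n \<subseteq> E" for n by (auto simp: D_def)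
    have E_F: "E - F \<subseteq> (\<Union>n. D n)"
    proof
      fix x assume x: "x \<in> E - F"
      then have "0 < infdist x F"
        using infdist_pos_not_in_closed[OF \<open>closed F\<close> F] by auto
      then obtain n where "1 < real n * infdist x F"
        using reals_Archimedean3 by blast
      then show "x \<in> (\<Union>n. D n)" using x by (auto simp: D_def intro: less_imp_le)
    qed
    \<comment> \<open>\<open>R n\<close> leaves out \<open>D (n + 1)\<close>, which keeps it away from \<open>D n\<close>.\<close>
    have sep: "\<mu> (D n) + \<mu> (R n) \<le> \<mu> (D (n + 2))" for n
    proof (cases "n = 0")
      case True
      have "D 0 = {}" by (auto simp: D_def)
      then show ?thesis using pos mono[of "R n" "D (n+2)"] True
        by (auto simp: R_def positive_def)
    next
      case n: False
      define e where "e = 1 / real n - 1 / real (n + 1)"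
      have "0 < e" using n by (simp add: e_def frac_less2)
      moreover have "e \<le> dist x y" if x: "x \<in> D n" and y: "y \<in> R n" for x y
      proof -
        have "1 / real n \<le> infdist x F" using x n by (simp add: D_def field_simps)
        moreover have "infdist y F < 1 / real (n + 1)"
          using y by (auto simp: R_def D_def field_simps)
        moreover have "infdist x F \<le> infdist y F + dist x y" by (rule infdist_triangle)
        ultimately show ?thesis by (simp add: e_def)
      qed
      ultimately have "\<mu> (D n) + \<mu> (R n) \<le> \<mu> (D n \<union> R n)" by (rule metric)
      also have "\<dots> \<le> \<mu> (D (n + 2))"
        using D_mono[of n "n + 2"] by (intro mono) (auto simp: R_def)
      finally show ?thesis .
    qed
    have parity: "(\<Sum>j<m. \<mu> (R (2 * j + p))) \<le> \<mu> (D (2 * m + p))" for m p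
    proof (induction m)
      case 0
      then show ?case by simp
    next
      case (Suc m)
      then have "(\<Sum>j<Suc m. \<mu> (R (2 * j + p))) \<le> \<mu> (D (2 * m + p)) + \<mu> (R (2 * m + p))"
        by (simp add: add_right_mono)
      also have "\<dots> \<le> \<mu> (D (2 * m + p + 2))" by (rule sep)
      finally show ?case by (simp add: add.commute add.left_commute)
    qed
    define S where "S = (\<Sum>j. \<mu> (R j))"
    have "S \<le> \<mu> E + \<mu> E"
      unfolding S_def
    proof (rule suminf_le_const[OF summableI])
      fix n
      have "(\<Sum>j<n. \<mu> (R j)) \<le> (\<Sum>j<2*n. \<mu> (R j))"
        by (intro sum_mono2) auto
      also have "\<dots> = (\<Sum>j<n. \<mu> (R (2 * j + 0))) + (\<Sum>j<n. \<mu> (R (2 * j + 1)))"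
        by (induction n) (simp_all add: algebra_simps)
      also have "\<dots> \<le> \<mu> E + \<mu> E"
        by (intro add_mono order_trans[OF parity] mono D_E)
      finally show "(\<Sum>j<n. \<mu> (R j)) \<le> \<mu> E + \<mu> E" .
    qed
    then have S: "S < \<infinity>" using False
      by (metis ennreal_add_eq_top infinity_ennreal_def less_top neq_top_trans)
    have "(\<Sum>j<n. \<mu> (R j)) + (\<mu> (E \<inter> F) + \<mu> (E - F)) \<le> S + \<mu> E" for n
    proof -
      have "E - F \<subseteq> D (n + 1) \<union> (\<Union>j. R (j + n))"
      proof
        fix x assume "x \<in> E - F"
        then obtain m where m: "x \<in> D m" using E_F by auto
        define l where "l = (LEAST m. x \<in> D m)"
        have l: "x \<in> D l" "\<And>i. i < l \<Longrightarrow> x \<notin> D i"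
          unfolding l_def using m by (auto intro: LeastI dest: not_less_Least)
        show "x \<in> D (n + 1) \<union> (\<Union>j. R (j + n))"
        proof (cases "l \<le> n + 1")
          case True
          then show ?thesis using l D_mono by blast
        next
          case False
          then obtain i where "l = i + n + 2"
            by (metis add.commute add.left_commute less_eq_Suc_le not_le one_add_one plus_1_eq_Suc add_Suc_right le_Suc_ex)
          then have "x \<in> R (i + n)"
            using l(1) l(2)[of "i + n + 1"] by (simp add: R_def)
          then show ?thesis by blast
        qed
      qed
      then have "\<mu> (E - F) \<le> \<mu> (D (n + 1) \<union> (\<Union>j. R (j + n)))" by (rule mono)
      also have "\<dots> \<le> \<mu> (D (n + 1)) + \<mu> (\<Union>j. R (j + n))" by (rule sa)
      also have "\<mu> (\<Union>j. R (j + n)) \<le> (\<Sum>j. \<mu> (R (j + n)))"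
      proof -
        have "disjoint_family (\<lambda>j. R (j + n))"
        proof (unfold disjoint_family_on_def, intro ballI impI)
          fix i j :: nat assume "i \<noteq> j"
          show "R (i + n) \<inter> R (j + n) = {}"
            using D_mono[of "i + n + 2" "j + n + 1"] D_mono[of "j + n + 2" "i + n + 1"] \<open>i \<noteq> j\<close>
            unfolding R_def by (cases "i < j") auto
        qed
        then show ?thesis using csa by (auto simp: countably_subadditive_def)
      qed
      finally have "\<mu> (E - F) \<le> \<mu> (D (n + 1)) + (\<Sum>j. \<mu> (R (j + n)))" by (simp add: add_left_mono)
      then have "(\<Sum>j<n. \<mu> (R j)) + (\<mu> (E \<inter> F) + \<mu> (E - F))
          \<le> (\<Sum>j<n. \<mu> (R j)) + (\<mu> (E \<inter> F) + (\<mu> (D (n + 1)) + (\<Sum>j. \<mu> (R (j + n)))))"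
        by (intro add_left_mono)
      also have "\<dots> = S + (\<mu> (E \<inter> F) + \<mu> (D (n + 1)))"
        unfolding S_def suminf_offset[OF summableI, of "\<lambda>j. \<mu> (R j)" n] by (simp add: ac_simps)
      also have "\<mu> (E \<inter> F) + \<mu> (D (n + 1)) \<le> \<mu> (E \<inter> F \<union> D (n + 1))"
      proof (rule metric)
        show "0 < 1 / real (n + 1)" by simp
        fix x y assume "x \<in> E \<inter> F" "y \<in> D (n + 1)"
        then have "infdist y F \<le> dist x y" "1 / real (n + 1) \<le> infdist y F"
          using infdist_le[of x F y] by (auto simp: D_def field_simps dist_commute)
        then show "1 / real (n + 1) \<le> dist x y" by simp
      qed
      also have "\<dots> \<le> \<mu> E" using D_E by (intro mono) auto
      finally show ?thesis by (simp add: add_left_mono)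
    qed
    \<comment> \<open>Keeping the partial sums on the left avoids any limit of tails: take the supremum over \<open>n\<close>
      and cancel the finite \<open>S\<close>.\<close>
    then have "S + (\<mu> (E \<inter> F) + \<mu> (E - F)) \<le> S + \<mu> E"
      unfolding S_def by (rule ennreal_suminf_bound_add)
    then show ?thesis using S by (auto simp: ennreal_add_left_cancel_le)
  qed
  then have "\<mu> (E \<inter> F) + \<mu> (E - F) = \<mu> E" for E
    using sa[of "E \<inter> F" "E - F"] by (intro antisym) (simp_all add: Int_Diff_Un)
  then show ?thesis
    using algebra.lambda_system_eq[OF algebra_Pow, of UNIV \<mu>] by simp
qed

section \<open>The Hausdorff measure is a measure\<close>

lemma hausdorff_premeasure_le:
  assumes "A \<subseteq> (\<Union>i. C i)" "\<And>i::nat. bounded (C i)" "\<And>i. diameter (C i) \<le> \<delta>"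
  shows "hausdorff_premeasure k \<delta> A \<le> (\<Sum>i. hausdorff_weight k (C i))"
  unfolding hausdorff_premeasure_def by (rule INF_lower) (use assms in auto)

lemma hausdorff_premeasure_ge:
  assumes "\<And>C :: nat \<Rightarrow> 'a::metric_space set. A \<subseteq> (\<Union>i. C i) \<Longrightarrow> (\<And>i. bounded (C i)) \<Longrightarrow>
    (\<And>i. diameter (C i) \<le> \<delta>) \<Longrightarrow> c \<le> (\<Sum>i. hausdorff_weight k (C i))"
  shows "c \<le> hausdorff_premeasure k \<delta> A"
  unfolding hausdorff_premeasure_def by (rule INF_greatest) (use assms in auto)

lemma hausdorff_premeasure_mono: "A \<subseteq> B \<Longrightarrow> hausdorff_premeasure k \<delta> A \<le> hausdorff_premeasure k \<delta> B"
  by (rule hausdorff_premeasure_ge) (blast intro: hausdorff_premeasure_le)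

lemma hausdorff_premeasure_antimono:
  "\<delta> \<le> \<epsilon> \<Longrightarrow> hausdorff_premeasure k \<epsilon> A \<le> hausdorff_premeasure k \<delta> A"
  by (rule hausdorff_premeasure_ge) (auto intro!: hausdorff_premeasure_le intro: order_trans)

lemma hausdorff_premeasure_le_outer:
  "0 < \<delta> \<Longrightarrow> hausdorff_premeasure k \<delta> A \<le> hausdorff_outer_measure k A"
  unfolding hausdorff_outer_measure_def by (rule SUP_upper) auto

lemma hausdorff_weight_empty [simp]: "hausdorff_weight k {} = 0"
  by (simp add: hausdorff_weight_def)

lemma hausdorff_premeasure_empty: "0 < \<delta> \<Longrightarrow> hausdorff_premeasure k \<delta> {} = 0"
  using hausdorff_premeasure_le[of "{}" "\<lambda>_. {}" \<delta> k] by simp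

lemma hausdorff_premeasure_countably_subadditive:
  fixes A :: "nat \<Rightarrow> 'a::metric_space set"
  shows "hausdorff_premeasure k \<delta> (\<Union>i. A i) \<le> (\<Sum>i. hausdorff_premeasure k \<delta> (A i))"
proof (rule ennreal_le_epsilon)
  let ?O = "hausdorff_premeasure k \<delta> :: 'a set \<Rightarrow> ennreal"
  fix e :: real assume "0 < e" "(\<Sum>n. ?O (A n)) < top"
  then have *: "?O (A n) < ?O (A n) + e * (1/2)^Suc n" for n
    by (auto simp add: less_top dest!: ennreal_suminf_lessD)
  have "\<exists>B. A n \<subseteq> (\<Union>i. B i) \<and> (\<forall>i. bounded (B i) \<and> diameter (B i) \<le> \<delta>) \<and>
      (\<Sum>i. hausdorff_weight k (B i)) < ?O (A n) + e * (1/2)^Suc n" for n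
    using *[of n] by (subst (asm) hausdorff_premeasure_def) (auto simp: INF_less_iff)
  then obtain B where B: "\<And>n. A n \<subseteq> (\<Union>i. B n i)" "\<And>n i. bounded (B n i)" "\<And>n i. diameter (B n i) \<le> \<delta>"
      "\<And>n. (\<Sum>i. hausdorff_weight k (B n i)) < ?O (A n) + e * (1/2)^Suc n"
    by metis
  define C where "C = case_prod B o prod_decode"
  have "?O (\<Union>i. A i) \<le> (\<Sum>i. hausdorff_weight k (C i))"
  proof (rule hausdorff_premeasure_le)
    show "(\<Union>i. A i) \<subseteq> (\<Union>i. C i)"
      using B(1) by (auto simp add: C_def subset_eq) (metis prod.case prod_encode_inverse)
  qed (auto simp: C_def split_def B)
  also have "\<dots> = (\<Sum>n. \<Sum>i. hausdorff_weight k (B n i))"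
    unfolding C_def comp_def by (intro suminf_ennreal_2dimen) auto
  also have "\<dots> \<le> (\<Sum>n. ?O (A n) + e * (1/2) ^ Suc n)"
    by (intro suminf_le allI less_imp_le B) auto
  also have "... = (\<Sum>n. ?O (A n)) + (\<Sum>n. ennreal e * ennreal ((1/2) ^ Suc n))"
    using \<open>0 < e\<close> by (subst suminf_add[symmetric])
      (auto simp del: ennreal_suminf_cmult simp add: ennreal_mult[symmetric])
  also have "\<dots> = (\<Sum>n. ?O (A n)) + e"
    unfolding ennreal_suminf_cmult
    by (subst suminf_ennreal_eq[OF zero_le_power power_half_series]) auto
  finally show "?O (\<Union>i. A i) \<le> (\<Sum>n. ?O (A n)) + e" .
qed

lemma outer_measure_space_hausdorff:
  "outer_measure_space UNIV (hausdorff_outer_measure k :: 'a::metric_space set \<Rightarrow> ennreal)"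
  unfolding outer_measure_space_def
proof (intro conjI)
  show "positive UNIV (hausdorff_outer_measure k :: 'a set \<Rightarrow> ennreal)"
    unfolding positive_def hausdorff_outer_measure_def
    using SUP_cong[of "{0<..}" "{0<..}" "\<lambda>\<delta>. hausdorff_premeasure k \<delta> ({} :: 'a set)" "\<lambda>_. 0"]
    by (simp add: hausdorff_premeasure_empty)
  show "increasing UNIV (hausdorff_outer_measure k :: 'a set \<Rightarrow> ennreal)"
    unfolding increasing_def hausdorff_outer_measure_def
    by (auto intro!: SUP_mono hausdorff_premeasure_mono)
  show "countably_subadditive UNIV (hausdorff_outer_measure k :: 'a set \<Rightarrow> ennreal)"
    unfolding countably_subadditive_def
  proof (intro allI impI)
    fix A :: "nat \<Rightarrow> 'a set"
    show "hausdorff_outer_measure k (\<Union>i. A i) \<le> (\<Sum>i. hausdorff_outer_measure k (A i))"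
      unfolding hausdorff_outer_measure_def[of k "\<Union>i. A i"]
      by (intro SUP_least order_trans[OF hausdorff_premeasure_countably_subadditive] suminf_le
            hausdorff_premeasure_le_outer summableI) auto
  qed
qed

text \<open>
  No set of diameter at most \<open>\<delta>\<close> meets both \<open>A\<close> and \<open>B\<close>, so a cover of the union splits into a
  cover of \<open>A\<close> and a disjoint cover of \<open>B\<close>. This strict form of separation at a fixed scale
  yields, as \<open>\<delta>\<close> tends to 0, additivity on sets at positive distance.
\<close>
lemma hausdorff_premeasure_separated:
  fixes A B :: "'a::metric_space set"
  assumes "0 < \<delta>" and sep: "\<And>x y. x \<in> A \<Longrightarrow> y \<in> B \<Longrightarrow> \<delta> < dist x y"
  shows "hausdorff_premeasure k \<delta> A + hausdorff_premeasure k \<delta> B \<le> hausdorff_premeasure k \<delta> (A \<union> B)"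
proof (rule hausdorff_premeasure_ge)
  fix C :: "nat \<Rightarrow> 'a set"
  assume C: "A \<union> B \<subseteq> (\<Union>i. C i)" "\<And>i. bounded (C i)" "\<And>i. diameter (C i) \<le> \<delta>"
  define CA where "CA i = (if C i \<inter> A = {} then {} else C i)" for i
  define CB where "CB i = (if C i \<inter> B = {} then {} else C i)" for i
  have disj: "C i \<inter> A = {} \<or> C i \<inter> B = {}" for i
    using sep diameter_bounded_bound[OF C(2)[of i]] C(3)[of i] by fastforce
  have "hausdorff_premeasure k \<delta> A \<le> (\<Sum>i. hausdorff_weight k (CA i))"
    using C \<open>0 < \<delta>\<close> by (intro hausdorff_premeasure_le) (auto simp: CA_def subset_iff, blast)
  moreover have "hausdorff_premeasure k \<delta> B \<le> (\<Sum>i. hausdorff_weight k (CB i))"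
    using C \<open>0 < \<delta>\<close> by (intro hausdorff_premeasure_le) (auto simp: CB_def subset_iff, blast)
  ultimately have "hausdorff_premeasure k \<delta> A + hausdorff_premeasure k \<delta> B
      \<le> (\<Sum>i. hausdorff_weight k (CA i)) + (\<Sum>i. hausdorff_weight k (CB i))"
    by (rule add_mono)
  also have "\<dots> = (\<Sum>i. hausdorff_weight k (CA i) + hausdorff_weight k (CB i))"
    by (intro suminf_add summableI)
  also have "\<dots> \<le> (\<Sum>i. hausdorff_weight k (C i))"
    using disj by (intro suminf_le summableI) (auto simp: CA_def CB_def)
  finally show "hausdorff_premeasure k \<delta> A + hausdorff_premeasure k \<delta> B
      \<le> (\<Sum>i. hausdorff_weight k (C i))" .
qed

lemma hausdorff_outer_measure_separated:
  fixes A B :: "'a::metric_space set"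
  assumes "0 < e" and sep: "\<And>x y. x \<in> A \<Longrightarrow> y \<in> B \<Longrightarrow> e \<le> dist x y"
  shows "hausdorff_outer_measure k A + hausdorff_outer_measure k B \<le> hausdorff_outer_measure k (A \<union> B)"
proof -
  have *: "hausdorff_premeasure k \<delta> A + hausdorff_premeasure k \<epsilon> B \<le> hausdorff_outer_measure k (A \<union> B)"
    if "0 < \<delta>" "0 < \<epsilon>" for \<delta> \<epsilon>
  proof -
    define \<gamma> where "\<gamma> = min (e / 2) (min \<delta> \<epsilon>)"
    have \<gamma>: "0 < \<gamma>" "\<gamma> < e" "\<gamma> \<le> \<delta>" "\<gamma> \<le> \<epsilon>" using that \<open>0 < e\<close> by (auto simp: \<gamma>_def)
    have "hausdorff_premeasure k \<delta> A + hausdorff_premeasure k \<epsilon> B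
        \<le> hausdorff_premeasure k \<gamma> A + hausdorff_premeasure k \<gamma> B"
      using \<gamma> by (intro add_mono hausdorff_premeasure_antimono) auto
    also have "\<dots> \<le> hausdorff_premeasure k \<gamma> (A \<union> B)"
      using \<gamma> sep by (intro hausdorff_premeasure_separated) force+
    also have "\<dots> \<le> hausdorff_outer_measure k (A \<union> B)"
      using \<gamma> by (intro hausdorff_premeasure_le_outer)
    finally show ?thesis .
  qed
  have "hausdorff_outer_measure k A + hausdorff_premeasure k \<epsilon> B \<le> hausdorff_outer_measure k (A \<union> B)"
    if "0 < \<epsilon>" for \<epsilon>
    unfolding hausdorff_outer_measure_def[of k A] using * that
    by (simp add: ennreal_SUP_add_left[symmetric] SUP_le_iff)
  then show ?thesis
    unfolding hausdorff_outer_measure_def[of k B]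
    by (simp add: ennreal_SUP_add_right SUP_le_iff)
qed

lemma measure_space_hausdorff_lambda_system:
  "measure_space UNIV (lambda_system UNIV UNIV (hausdorff_outer_measure k))
    (hausdorff_outer_measure k :: 'a::metric_space set \<Rightarrow> ennreal)"
  using sigma_algebra.caratheodory_lemma[OF sigma_algebra_Pow,
      of UNIV "hausdorff_outer_measure k :: 'a set \<Rightarrow> ennreal"]
    outer_measure_space_hausdorff[of k, where ?'a = 'a] by simp

lemma borel_subset_hausdorff_lambda_system:
  "sets borel \<subseteq> lambda_system UNIV UNIV (hausdorff_outer_measure k :: 'a::metric_space set \<Rightarrow> ennreal)"
proof -
  let ?L = "lambda_system UNIV UNIV (hausdorff_outer_measure k :: 'a set \<Rightarrow> ennreal)"
  have "sigma_algebra UNIV ?L"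
    using measure_space_hausdorff_lambda_system[of k, where ?'a = 'a] by (simp add: measure_space_def)
  moreover have "Collect closed \<subseteq> ?L"
    by (auto intro!: closed_in_lambda_system outer_measure_space_hausdorff
        elim: hausdorff_outer_measure_separated)
  ultimately have "sigma_sets UNIV (Collect closed) \<subseteq> ?L"
    by (rule sigma_algebra.sigma_sets_subset)
  then show ?thesis by (simp add: borel_eq_closed)
qed

lemma sets_hausdorff_measure [simp]: "sets (hausdorff_measure k) = sets borel"
  unfolding hausdorff_measure_def using sets.sigma_sets_eq[of borel] by simp

lemma space_hausdorff_measure [simp]: "space (hausdorff_measure k) = UNIV"
  unfolding hausdorff_measure_def by simp

lemma measurable_hausdorff_measure [simp]: "measurable (hausdorff_measure k) M = measurable borel M"
  by (rule measurable_cong_sets) auto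

lemma emeasure_hausdorff_measure:
  fixes A :: "'a::metric_space set"
  assumes "A \<in> sets borel"
  shows "emeasure (hausdorff_measure k) A = hausdorff_outer_measure k A"
proof -
  note ms = measure_space_hausdorff_lambda_system[of k, where ?'a = 'a]
  have "sigma_algebra UNIV (sets (borel :: 'a measure))"
    using sets.sigma_algebra_axioms[of "borel :: 'a measure"] by simp
  moreover have "positive (sets borel) (hausdorff_outer_measure k :: 'a set \<Rightarrow> ennreal)"
    using ms by (simp add: measure_space_def positive_def)
  moreover have "countably_additive (sets borel) (hausdorff_outer_measure k :: 'a set \<Rightarrow> ennreal)"
    using ms borel_subset_hausdorff_lambda_system[of k]
    by (auto simp: measure_space_def countably_additive_def)
  ultimately show ?thesis
    unfolding hausdorff_measure_def using assms by (intro emeasure_measure_of_sigma)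
qed

text \<open>
  An isometry carries covers to covers of the same weight. One inequality is enough for an involution:
  applied twice, it gives equality.
\<close>
lemma hausdorff_premeasure_isometry_le:
  fixes f :: "'a::metric_space \<Rightarrow> 'b::metric_space"
  assumes iso: "\<And>x y. dist (f x) (f y) = dist x y"
  shows "hausdorff_premeasure k \<delta> (f ` A) \<le> hausdorff_premeasure k \<delta> A"
proof (rule hausdorff_premeasure_ge)
  fix C :: "nat \<Rightarrow> 'a set"
  assume C: "A \<subseteq> (\<Union>i. C i)" "\<And>i. bounded (C i)" "\<And>i. diameter (C i) \<le> \<delta>"
  have diam: "diameter (f ` S) = diameter S" for S
  proof -
    have "f ` S \<times> f ` S = (\<lambda>(x, y). (f x, f y)) ` (S \<times> S)"
      by (simp add: image_paired_Times)
    then show ?thesis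
      by (simp add: diameter_def image_image case_prod_unfold iso)
  qed
  have "bounded (f ` C i)" for i
    using C(2)[of i] unfolding bounded_def by (metis (no_types, lifting) image_iff iso)
  then have "hausdorff_premeasure k \<delta> (f ` A) \<le> (\<Sum>i. hausdorff_weight k (f ` C i))"
    using C(1,3) by (intro hausdorff_premeasure_le) (auto simp: diam, blast)
  also have "(\<lambda>i. hausdorff_weight k (f ` C i)) = (\<lambda>i. hausdorff_weight k (C i))"
    by (rule ext) (simp add: hausdorff_weight_def diam)
  finally show "hausdorff_premeasure k \<delta> (f ` A) \<le> (\<Sum>i. hausdorff_weight k (C i))" .
qed

lemma hausdorff_outer_measure_isometry_le:
  fixes f :: "'a::metric_space \<Rightarrow> 'b::metric_space"
  assumes "\<And>x y. dist (f x) (f y) = dist x y"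
  shows "hausdorff_outer_measure k (f ` A) \<le> hausdorff_outer_measure k A"
  unfolding hausdorff_outer_measure_def
  by (auto intro!: SUP_mono hausdorff_premeasure_isometry_le[OF assms])

lemma distr_hausdorff_measure_involution:
  fixes f :: "'a::metric_space \<Rightarrow> 'a"
  assumes iso: "\<And>x y. dist (f x) (f y) = dist x y" and inv: "\<And>x. f (f x) = x"
  shows "distr (hausdorff_measure k) borel f = hausdorff_measure k"
proof (rule measure_eqI)
  fix A assume "A \<in> sets (distr (hausdorff_measure k) borel f)"
  then have A: "A \<in> sets borel" by simp
  have "continuous_on UNIV f" unfolding continuous_on_iff iso by blast
  then have f: "f \<in> borel_measurable borel" by (rule borel_measurable_continuous_onI)
  then have "f -` A \<in> sets borel" using measurable_sets[OF f A] by simp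
  moreover have "f ` A = f -` A" using inv by (auto simp: image_iff) metis
  moreover have "f ` (f ` A) = A" by (simp add: image_image inv)
  ultimately show "emeasure (distr (hausdorff_measure k) borel f) A = emeasure (hausdorff_measure k) A"
    using A f hausdorff_outer_measure_isometry_le[of f k A, OF iso]
      hausdorff_outer_measure_isometry_le[of f k "f ` A", OF iso]
    by (simp add: emeasure_distr emeasure_hausdorff_measure)
qed simp

section \<open>Sets of finite positive Hausdorff measure\<close>

lemma hausdorff_premeasure_le_finite_cover:
  fixes A :: "'a::metric_space set"
  assumes "finite I" "A \<subseteq> (\<Union>i\<in>I. C i)" "\<And>i. i \<in> I \<Longrightarrow> bounded (C i)"
    and diam: "\<And>i. i \<in> I \<Longrightarrow> diameter (C i) \<le> d" and "0 \<le> d" "d \<le> \<delta>"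
  shows "hausdorff_premeasure k \<delta> A \<le> ennreal (real (card I) * (unit_ball_vol (real k) * (d / 2) ^ k))"
proof -
  obtain h where h: "bij_betw h {0..<card I} I"
    using ex_bij_betw_nat_finite[OF \<open>finite I\<close>] by blast
  define C' where "C' n = (if n < card I then C (h n) else {})" for n
  have hI: "h n \<in> I" if "n < card I" for n
    using h that by (auto simp: bij_betw_def)
  have "hausdorff_premeasure k \<delta> A \<le> (\<Sum>n. hausdorff_weight k (C' n))"
  proof (rule hausdorff_premeasure_le)
    show "A \<subseteq> (\<Union>n. C' n)"
    proof
      fix x assume "x \<in> A"
      then obtain i where i: "i \<in> I" "x \<in> C i" using assms(2) by blast
      then obtain n where "n < card I" "h n = i"
        using bij_betw_imp_surj_on[OF h] by (metis atLeastLessThan_iff imageE)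
      then have "x \<in> C' n" using i by (simp add: C'_def)
      then show "x \<in> (\<Union>n. C' n)" by blast
    qed
    show "bounded (C' n)" for n using assms(3) hI by (simp add: C'_def)
    show "diameter (C' n) \<le> \<delta>" for n
      using diam hI[of n] \<open>0 \<le> d\<close> \<open>d \<le> \<delta>\<close> by (auto simp: C'_def intro: order_trans)
  qed
  also have "\<dots> = (\<Sum>n<card I. hausdorff_weight k (C' n))"
    by (intro suminf_finite) (auto simp: C'_def)
  also have "\<dots> \<le> (\<Sum>n<card I. ennreal (unit_ball_vol (real k) * (d / 2) ^ k))"
  proof (rule sum_mono)
    fix n assume "n \<in> {..<card I}"
    then have n: "h n \<in> I" "C' n = C (h n)" using hI by (auto simp: C'_def)
    have "(diameter (C (h n)) / 2) ^ k \<le> (d / 2) ^ k"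
      using diam[OF n(1)] diameter_ge_0[OF assms(3)[OF n(1)]] by (intro power_mono) auto
    then show "hausdorff_weight k (C' n) \<le> ennreal (unit_ball_vol (real k) * (d / 2) ^ k)"
      by (auto simp: hausdorff_weight_def n intro!: ennreal_leI mult_left_mono)
  qed
  also have "\<dots> = ennreal (real (card I) * (unit_ball_vol (real k) * (d / 2) ^ k))"
    using \<open>0 \<le> d\<close> by (simp add: ennreal_mult ennreal_of_nat_eq_real_of_nat)
  finally show ?thesis .
qed

text \<open>
  Coordinates along an orthonormal basis of the directions of \<open>A\<close> place it in a \<open>k\<close>-dimensional cube.
  Cutting the cube into \<open>n ^ k\<close> small cubes gives covers with arbitrarily small pieces, of total
  weight independent of \<open>n\<close>, because the weight of each is proportional to \<open>(1 / n) ^ k\<close>.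
\<close>
lemma hausdorff_outer_measure_finite:
  fixes A :: "'a::euclidean_space set"
  assumes "bounded A" and dim: "aff_dim A = int k"
  shows "hausdorff_outer_measure k A < \<infinity>"
proof -
  obtain a where a: "a \<in> A" using dim by (cases "A = {}") auto
  define V where "V = span ((\<lambda>x. x - a) ` A)"
  have "dim V = k"
    using aff_dim_eq_dim_subtract[of a A] dim hull_inc[OF a] by (simp add: V_def)
  then obtain S where S: "pairwise orthogonal S" "\<And>x. x \<in> S \<Longrightarrow> norm x = 1" "independent S"
      "card S = k" "span S = V"
    using orthonormal_basis_subspace[of V] by (metis V_def subspace_span)
  have "finite S" using S(3) by (rule independent_imp_finite)
  have expand: "(\<Sum>v\<in>S. ((x - y) \<bullet> v) *\<^sub>R v) = x - y" if "x \<in> A" "y \<in> A" for x y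
  proof (rule orthonormal_basis_expand[OF S(1,2) _ \<open>finite S\<close>])
    have "x - a \<in> span S" "y - a \<in> span S"
      using that by (auto simp: S(5) V_def intro: span_base)
    then have "(x - a) - (y - a) \<in> span S" by (rule span_diff)
    then show "x - y \<in> span S" by simp
  qed
  obtain R where R: "0 < R" "\<And>x. x \<in> A \<Longrightarrow> norm (x - a) < R"
  proof -
    have "bounded ((\<lambda>x. x - a) ` A)" using \<open>bounded A\<close> by (rule bounded_translation_minus)
    then obtain R where "0 < R" "\<And>x. x \<in> (\<lambda>x. x - a) ` A \<Longrightarrow> norm x < R"
      unfolding bounded_pos_less by blast
    then show ?thesis using that by blast
  qed
  have coord: "-R < (x - a) \<bullet> v" "(x - a) \<bullet> v < R" if "x \<in> A" "v \<in> S" for x v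
    using Cauchy_Schwarz_ineq2[of "x - a" v] R(2)[OF that(1)] S(2)[OF that(2)] by auto
  \<comment> \<open>Cut the bounding cube of side \<open>2R\<close> into \<open>n ^ k\<close> subcubes of side \<open>2R / n\<close>.\<close>
  have bound: "hausdorff_premeasure k \<delta> A \<le> ennreal (unit_ball_vol (real k) * (real k * R) ^ k)"
    if "0 < \<delta>" for \<delta>
  proof -
    obtain n where n: "2 * real k * R / \<delta> < real n" "0 < n"
      using reals_Archimedean2[of "max 0 (2 * real k * R / \<delta>)"] by (auto simp: max_def split: if_splits)
    define cell where "cell x = restrict (\<lambda>v. nat \<lfloor>((x - a) \<bullet> v + R) * n / (2 * R)\<rfloor>) S" for x
    define d where "d = real k * (2 * R / n)"
    have cell_range: "cell x \<in> S \<rightarrow>\<^sub>E {..<n}" if "x \<in> A" for x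
    proof -
      have "nat \<lfloor>((x - a) \<bullet> v + R) * n / (2 * R)\<rfloor> < n" if v: "v \<in> S" for v
      proof -
        have "((x - a) \<bullet> v + R) * n < (2 * R) * n"
          using coord[OF \<open>x \<in> A\<close> v] n by (intro mult_strict_right_mono) auto
        then have "((x - a) \<bullet> v + R) * n / (2 * R) < real n"
          using R(1) by (simp add: divide_less_eq mult.commute)
        then show ?thesis using n by linarith
      qed
      then show ?thesis by (auto simp: cell_def)
    qed
    have cell_diam: "diameter {x \<in> A. cell x = i} \<le> d" for i
    proof (rule diameter_le)
      show "{x \<in> A. cell x = i} \<noteq> {} \<or> 0 \<le> d" using R n by (simp add: d_def)
      fix x y assume "x \<in> {x \<in> A. cell x = i}" "y \<in> {x \<in> A. cell x = i}"
      then have xy: "x \<in> A" "y \<in> A" "cell x = cell y" by auto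
      have "\<bar>(x - y) \<bullet> v\<bar> \<le> 2 * R / n" if v: "v \<in> S" for v
      proof -
        define p q where "p = ((x - a) \<bullet> v + R) * n / (2 * R)" and "q = ((y - a) \<bullet> v + R) * n / (2 * R)"
        have "0 \<le> p" "0 \<le> q"
          using coord[OF xy(1) v] coord[OF xy(2) v] R(1) by (simp_all add: p_def q_def)
        moreover have "nat \<lfloor>p\<rfloor> = nat \<lfloor>q\<rfloor>"
          using fun_cong[OF xy(3), of v] v by (simp add: cell_def p_def q_def)
        ultimately have "\<bar>p - q\<bar> \<le> 1" by linarith
        moreover have "p - q = ((x - y) \<bullet> v) * (n / (2 * R))"
          by (simp add: p_def q_def inner_diff_left field_simps diff_divide_distrib add_divide_distrib)
        ultimately have "\<bar>(x - y) \<bullet> v\<bar> * (n / (2 * R)) \<le> 1"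
          using R(1) by (simp add: abs_mult)
        then show ?thesis using R(1) n by (simp add: field_simps)
      qed
      then have "norm (\<Sum>v\<in>S. ((x - y) \<bullet> v) *\<^sub>R v) \<le> (\<Sum>v\<in>S. 2 * R / n)"
        by (intro sum_norm_le) (simp add: S(2))
      then show "norm (x - y) \<le> d"
        by (simp add: expand[OF xy(1,2)] S(4) d_def)
    qed
    have "hausdorff_premeasure k \<delta> A
        \<le> ennreal (real (card (S \<rightarrow>\<^sub>E {..<n})) * (unit_ball_vol (real k) * (d / 2) ^ k))"
    proof (rule hausdorff_premeasure_le_finite_cover)
      show "finite (S \<rightarrow>\<^sub>E {..<n})" using \<open>finite S\<close> by (simp add: finite_PiE)
      show "A \<subseteq> (\<Union>i\<in>S \<rightarrow>\<^sub>E {..<n}. {x \<in> A. cell x = i})" using cell_range by auto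
      show "bounded {x \<in> A. cell x = i}" for i by (rule bounded_subset[OF \<open>bounded A\<close>]) auto
      show "0 \<le> d" using R by (simp add: d_def)
      show "d \<le> \<delta>" using n that by (simp add: d_def field_simps)
    qed (rule cell_diam)
    also have "real (card (S \<rightarrow>\<^sub>E {..<n})) * (unit_ball_vol (real k) * (d / 2) ^ k)
        = unit_ball_vol (real k) * (real k * R) ^ k"
      using n \<open>finite S\<close> by (simp add: card_PiE S(4) d_def power_mult_distrib power_divide)
    finally show ?thesis .
  qed
  have "hausdorff_outer_measure k A \<le> ennreal (unit_ball_vol (real k) * (real k * R) ^ k)"
    unfolding hausdorff_outer_measure_def by (rule SUP_least) (use bound in auto)
  then show ?thesis by (simp add: le_less_trans)
qed

text \<open>
  Taking the complement among the coordinate directions, rather than orthogonal to \<open>V\<close>, makes the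
  thickened covers of the next proof axis-parallel boxes, whose Lebesgue measure is explicit.
\<close>
lemma coordinate_complement:
  fixes V :: "'a::euclidean_space set"
  obtains B where "B \<subseteq> Basis" "card B + dim V = DIM('a)" "span (V \<union> B) = UNIV"
proof -
  obtain S where S: "S \<subseteq> V" "independent S" "V \<subseteq> span S" "card S = dim V"
    using basis_exists by metis
  obtain C where C: "S \<subseteq> C" "C \<subseteq> S \<union> Basis" "independent C" "S \<union> Basis \<subseteq> span C"
    using maximal_independent_subset_extend[of S "S \<union> Basis"] S(2) by auto
  have span_C: "span C = UNIV"
    using span_mono[of Basis "span C"] C(4) by (auto simp: span_span)
  have fin: "finite C" using C(3) by (rule independent_imp_finite)
  have "card C = DIM('a)"
    using dim_eq_card_independent[OF C(3)] dim_span[of C] span_C by simp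
  moreover have "card (C - S) = card C - card S"
    using C(1) fin by (intro card_Diff_subset) (auto intro: finite_subset)
  moreover have "card S \<le> card C" using C(1) fin by (intro card_mono)
  ultimately have "card (C - S) + dim V = DIM('a)" using S(4) by simp
  moreover have "span (V \<union> (C - S)) = UNIV"
    using span_mono[of C "V \<union> (C - S)"] S(1) span_C by auto
  ultimately show ?thesis using C(2) by (intro that[of "C - S"]) auto
qed

text \<open>
  Thicken \<open>A\<close> by the unit ball \<open>Q\<close> of a complementary coordinate subspace. The result \<open>P\<close> is convex and
  of full dimension, so it has positive Lebesgue measure. Thickening a set of diameter \<open>d\<close>
  yields a subset of a box with \<open>k\<close> sides of length \<open>2 * d\<close> and all other sides of length 4,
  and the volume of that box is a constant multiple of the weight of the covering set. Hence the
  total weight of a cover cannot be less than a fixed multiple of the measure of \<open>P\<close>.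
\<close>
lemma hausdorff_outer_measure_pos:
  fixes A :: "'a::euclidean_space set"
  assumes "compact A" "convex A" and dim: "aff_dim A = int k"
  shows "0 < hausdorff_outer_measure k A"
proof -
  obtain a where a: "a \<in> A" using dim by (cases "A = {}") auto
  define D where "D = (\<lambda>x. x - a) ` A"
  have "dim D = k"
    using aff_dim_eq_dim_subtract[of a A] dim hull_inc[OF a] by (simp add: D_def)
  then obtain B where B: "B \<subseteq> Basis" "card B + k = DIM('a)" "span (D \<union> B) = UNIV"
    using coordinate_complement[of D] by metis
  have "finite B" using B(1) finite_Basis by (rule finite_subset)
  define Q where "Q = span B \<inter> cball 0 1"
  define P where "P = (\<Union>x\<in>A. \<Union>w\<in>Q. {x + w})"
  have Q0: "0 \<in> Q" by (simp add: Q_def span_zero)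
  have "compact Q" unfolding Q_def by (intro closed_Int_compact closed_span compact_cball)
  then have "compact P" unfolding P_def using \<open>compact A\<close> by (intro compact_sums')
  have "convex P" unfolding P_def Q_def
    by (intro convex_sums convex_Int \<open>convex A\<close> convex_cball subspace_imp_convex subspace_span)
  have "D \<union> B \<subseteq> (\<lambda>x. x - a) ` P"
  proof -
    have "D \<subseteq> (\<lambda>x. x - a) ` P" unfolding D_def P_def using Q0 by (intro image_mono) force
    moreover have "b \<in> (\<lambda>x. x - a) ` P" if "b \<in> B" for b
    proof -
      have "b \<in> Q" using that B(1) by (auto simp: Q_def span_base)
      then have "a + b \<in> P" using a by (auto simp: P_def)
      then show ?thesis by (rule rev_image_eqI) simp
    qed
    ultimately show ?thesis by blast
  qed
  then have "span ((\<lambda>x. x - a) ` P) = UNIV" using span_mono B(3) by (metis top.extremum_unique)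
  then have "dim ((\<lambda>x. x - a) ` P) = DIM('a)" by (metis dim_span dim_UNIV)
  moreover have "a \<in> P" using a Q0 by (force simp: P_def)
  ultimately have "aff_dim P = int (DIM('a))"
    using aff_dim_eq_dim_subtract[of a P] hull_inc[of a P] by simp
  then have "affine hull P = UNIV" by (simp add: aff_dim_eq_full)
  then have "interior P \<noteq> {}"
    using rel_interior_interior rel_interior_eq_empty[OF \<open>convex P\<close>] \<open>a \<in> P\<close> by auto
  then have "\<not> negligible P"
    using open_not_negligible[OF open_interior] negligible_subset[OF _ interior_subset] by blast
  then have P_pos: "emeasure lborel P \<noteq> 0"
    using negligible_iff_emeasure0[of P] \<open>compact P\<close> by (simp add: lmeasurable_compact fmeasurableD borel_compact)
  \<comment> \<open>\<open>\<kappa>\<close> is the ratio of weight to volume, \<open>unit_ball_vol k * (d / 2) ^ k\<close> to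
    \<open>4 ^ card B * (2 * d) ^ k\<close>; here \<open>card B + k\<close> is the dimension of the space.\<close>
  define \<kappa> where "\<kappa> = unit_ball_vol (real k) / 4 ^ DIM('a)"
  have "0 < \<kappa>" by (simp add: \<kappa>_def)
  have "ennreal \<kappa> * emeasure lborel P \<le> hausdorff_premeasure k 1 A"
  proof (rule hausdorff_premeasure_ge)
    fix C :: "nat \<Rightarrow> 'a set"
    assume C: "A \<subseteq> (\<Union>i. C i)" "\<And>i. bounded (C i)" "\<And>i. diameter (C i) \<le> 1"
    define c where "c i = (SOME x. x \<in> C i)" for i
    have c: "c i \<in> C i" if "C i \<noteq> {}" for i
      using that unfolding c_def by (simp add: some_in_eq)
    \<comment> \<open>Half-sides of the boxes: in the directions of \<open>B\<close>, 1 for the diameter of the covering set and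
      1 for the thickening.\<close>
    define h :: "nat \<Rightarrow> 'a" where "h i = (\<Sum>b\<in>Basis. (if b \<in> B then 2 else diameter (C i)) *\<^sub>R b)" for i
    have h: "h i \<bullet> b = (if b \<in> B then 2 else diameter (C i))" if "b \<in> Basis" for i b
      using that by (simp add: h_def)
    define X where "X i = (if C i = {} then {} else cbox (c i - h i) (c i + h i))" for i
    have X_sets: "X i \<in> sets lborel" for i by (simp add: X_def)
    have "P \<subseteq> (\<Union>i. X i)"
    proof
      fix x assume "x \<in> P"
      then obtain m w where mw: "m \<in> A" "w \<in> Q" "x = m + w" by (auto simp: P_def)
      then obtain i where i: "m \<in> C i" using C(1) by blast
      then have ci: "c i \<in> C i" using c by blast
      have dm: "\<bar>(m - c i) \<bullet> b\<bar> \<le> diameter (C i)" if "b \<in> Basis" for b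
        using diameter_bounded_bound[OF C(2) i ci] Basis_le_norm[OF that, of "m - c i"]
        by (simp add: dist_norm)
      have "\<bar>(x - c i) \<bullet> b\<bar> \<le> h i \<bullet> b" if b: "b \<in> Basis" for b
      proof (cases "b \<in> B")
        case True
        have "\<bar>w \<bullet> b\<bar> \<le> 1" using mw(2) Basis_le_norm[OF b, of w] by (simp add: Q_def)
        moreover have "\<bar>(m - c i) \<bullet> b\<bar> \<le> 1" using dm[OF b] C(3)[of i] by simp
        ultimately show ?thesis using True b by (simp add: h mw inner_diff_left inner_add_left)
      next
        case False
        have "orthogonal b w"
        proof (rule orthogonal_to_span)
          show "w \<in> span B" using mw(2) by (simp add: Q_def)
          show "orthogonal b y" if "y \<in> B" for y
            using that False B(1) b by (auto simp: orthogonal_def inner_Basis)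
        qed
        then have "w \<bullet> b = 0" by (simp add: orthogonal_def inner_commute)
        then show ?thesis using False b dm[OF b] by (simp add: h mw inner_diff_left inner_add_left)
      qed
      then have "x \<in> cbox (c i - h i) (c i + h i)"
        by (auto simp: mem_box inner_diff_left inner_add_left abs_le_iff algebra_simps)
      then show "x \<in> (\<Union>i. X i)" using ci by (auto simp: X_def)
    qed
    then have "emeasure lborel P \<le> emeasure lborel (\<Union>i. X i)"
      using X_sets by (intro emeasure_mono) auto
    also have "\<dots> \<le> (\<Sum>i. emeasure lborel (X i))"
      using X_sets by (intro emeasure_subadditive_countably) auto
    finally have "ennreal \<kappa> * emeasure lborel P \<le> (\<Sum>i. ennreal \<kappa> * emeasure lborel (X i))"
      by (simp add: mult_left_mono)
    moreover have "ennreal \<kappa> * emeasure lborel (X i) = hausdorff_weight k (C i)" for i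
    proof (cases "C i = {}")
      case True
      then show ?thesis by (simp add: X_def)
    next
      case False
      let ?d = "diameter (C i)"
      have d: "0 \<le> ?d" using C(2) by (rule diameter_ge_0)
      have "card (Basis - B) = k" using B(1,2) \<open>finite B\<close> by (simp add: card_Diff_subset)
      then have "(\<Prod>b\<in>Basis. if b \<in> B then 4 else 2 * ?d) = 4 ^ card B * (2 * ?d) ^ k"
        using B(1) by (subst prod.If_cases) (auto simp: Int_absorb1 Diff_eq[symmetric])
      moreover have "(\<Prod>b\<in>Basis. 2 * (h i \<bullet> b)) = (\<Prod>b\<in>Basis. if b \<in> B then 4 else 2 * ?d)"
        by (intro prod.cong) (simp_all add: h)
      moreover have "emeasure lborel (X i) = ennreal (\<Prod>b\<in>Basis. 2 * (h i \<bullet> b))"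
        using False d by (simp add: X_def emeasure_lborel_cbox_eq h inner_diff_left inner_add_left)
      ultimately have "ennreal \<kappa> * emeasure lborel (X i) = ennreal \<kappa> * ennreal (4 ^ card B * (2 * ?d) ^ k)"
        by (simp only:)
      also have "\<dots> = ennreal (\<kappa> * (4 ^ card B * (2 * ?d) ^ k))"
        using \<open>0 < \<kappa>\<close> d by (intro ennreal_mult[symmetric]) auto
      also have "\<kappa> * (4 ^ card B * (2 * ?d) ^ k) = unit_ball_vol (real k) * (?d / 2) ^ k"
      proof -
        have "2 * ?d = 4 * (?d / 2)" by simp
        then have "(2 * ?d) ^ k = 4 ^ k * (?d / 2) ^ k" by (simp only: power_mult_distrib)
        then show ?thesis unfolding \<kappa>_def B(2)[symmetric] by (simp add: power_add)
      qed
      finally show ?thesis using False by (simp add: hausdorff_weight_def)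
    qed
    ultimately show "ennreal \<kappa> * emeasure lborel P \<le> (\<Sum>i. hausdorff_weight k (C i))"
      by (simp only:)
  qed
  also have "\<dots> \<le> hausdorff_outer_measure k A" by (rule hausdorff_premeasure_le_outer) simp
  finally show ?thesis using P_pos \<open>0 < \<kappa>\<close> by (auto simp: less_le_trans zero_less_iff_neq_zero)
qed

section \<open>Reflections\<close>

lemma hyperplane_reflection_involution:
  assumes "norm \<omega> = 1"
  shows "hyperplane_reflection l \<omega> (hyperplane_reflection l \<omega> x) = x"
  using assms by (simp add: hyperplane_reflection_def inner_diff_left dot_square_norm algebra_simps)

lemma inner_hyperplane_reflection:
  assumes "norm \<omega> = 1"
  shows "hyperplane_reflection l \<omega> x \<bullet> \<omega> = 2 * l - x \<bullet> \<omega>"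
  using assms by (simp add: hyperplane_reflection_def inner_diff_left dot_square_norm)

text \<open>
  Two points on the same side of the hyperplane are at most as far apart as either is from the mirror
  image of the other; the last summand measures the excess.
\<close>
lemma dist_hyperplane_reflection:
  assumes "norm \<omega> = 1"
  shows "(dist y (hyperplane_reflection l \<omega> x))\<^sup>2 = (dist y x)\<^sup>2 + 4 * (x \<bullet> \<omega> - l) * (y \<bullet> \<omega> - l)"
proof -
  define t where "t = x \<bullet> \<omega> - l"
  have "\<omega> \<bullet> \<omega> = 1" using assms by (simp add: dot_square_norm)
  then have "((y - x) + (2 * t) *\<^sub>R \<omega>) \<bullet> ((y - x) + (2 * t) *\<^sub>R \<omega>)
      = (y - x) \<bullet> (y - x) + 4 * t * ((y - x) \<bullet> \<omega>) + 4 * t * t"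
    by (simp only: inner_add_left inner_add_right inner_scaleR_left inner_scaleR_right
        inner_commute[of \<omega> "y - x"]) (simp add: algebra_simps)
  moreover have "y - hyperplane_reflection l \<omega> x = (y - x) + (2 * t) *\<^sub>R \<omega>"
    by (simp add: hyperplane_reflection_def t_def)
  moreover have "(y - x) \<bullet> \<omega> = (y \<bullet> \<omega> - l) - t" by (simp add: t_def inner_diff_left)
  moreover have "p + 4 * t * (u - t) + 4 * t * t = p + 4 * t * u" for p u :: real
    by (simp add: algebra_simps)
  ultimately show ?thesis
    unfolding dist_norm power2_norm_eq_inner t_def[symmetric] by (simp only:)
qed

lemma hyperplane_reflection_isometry:
  assumes "norm \<omega> = 1"
  shows "dist (hyperplane_reflection l \<omega> x) (hyperplane_reflection l \<omega> y) = dist x y"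
proof -
  let ?T = "hyperplane_reflection l \<omega>"
  have cancel: "p + 4 * (a - l) * (b - l) + 4 * (b - l) * (2 * l - a - l) = p" for p a b :: real
    by (simp add: algebra_simps)
  have "(dist (?T x) (?T y))\<^sup>2 = (dist y (?T x))\<^sup>2 + 4 * (y \<bullet> \<omega> - l) * (2 * l - x \<bullet> \<omega> - l)"
    using dist_hyperplane_reflection[OF assms, of "?T x" l y]
    unfolding inner_hyperplane_reflection[OF assms] dist_commute[of "?T x" y] .
  then have "(dist (?T x) (?T y))\<^sup>2 = (dist y x)\<^sup>2"
    unfolding dist_hyperplane_reflection[OF assms, of y l x] cancel .
  then have "dist (?T x) (?T y) = dist y x" by (rule power2_eq_imp_eq) (rule zero_le_dist)+
  then show ?thesis by (rule trans) (rule dist_commute)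
qed

section \<open>The center of mass\<close>

lemma integrable_indicator_continuous:
  fixes f :: "'a::metric_space \<Rightarrow> 'b::{banach, second_countable_topology}"
  assumes "compact M" "emeasure (hausdorff_measure k) M < \<infinity>" "continuous_on UNIV f"
  shows "integrable (hausdorff_measure k) (\<lambda>y. indicator M y *\<^sub>R f y)"
proof -
  have "bounded (f ` M)"
    using compact_continuous_image[OF continuous_on_subset[OF assms(3)] assms(1)]
    by (simp add: compact_imp_bounded)
  then obtain b where "\<forall>y\<in>M. norm (f y) \<le> b" by (auto simp: bounded_iff)
  then show ?thesis
    using assms by (intro integrableI_bounded_set_indicator[where B = b])
      (auto simp: borel_compact borel_measurable_continuous_onI)
qed

lemma integral_nonpos:
  fixes f :: "'a \<Rightarrow> real"
  assumes "\<And>x. f x \<le> 0"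
  shows "integral\<^sup>L M f \<le> 0"
proof -
  have "0 \<le> (\<integral>x. - f x \<partial>M)" using assms by (intro Bochner_Integration.integral_nonneg) simp
  then show ?thesis by simp
qed

lemma center_of_mass_inner_le:
  fixes M :: "'a::euclidean_space set"
  assumes M: "compact M" "0 < emeasure (hausdorff_measure k) M" "emeasure (hausdorff_measure k) M < \<infinity>"
    and le: "(\<integral>y. indicator M y *\<^sub>R (y \<bullet> a - l) \<partial>hausdorff_measure k) \<le> 0"
  shows "hausdorff_center_of_mass k M \<bullet> a \<le> l"
proof -
  let ?\<nu> = "hausdorff_measure k :: 'a measure"
  define m where "m = measure ?\<nu> M"
  have "0 < m"
    using M by (simp add: m_def measure_def enn2real_positive_iff)
  have int: "integrable ?\<nu> (\<lambda>y. indicator M y *\<^sub>R y)" "integrable ?\<nu> (\<lambda>y. indicator M y *\<^sub>R l)"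
    by (intro integrable_indicator_continuous M continuous_intros)+
  have "(\<integral>y. indicator M y *\<^sub>R (y \<bullet> a - l) \<partial>?\<nu>)
      = (\<integral>y. (indicator M y *\<^sub>R y) \<bullet> a - indicator M y *\<^sub>R l \<partial>?\<nu>)"
    by (simp add: algebra_simps)
  also have "\<dots> = (\<integral>y. (indicator M y *\<^sub>R y) \<bullet> a \<partial>?\<nu>) - (\<integral>y. indicator M y *\<^sub>R l \<partial>?\<nu>)"
    using int by (intro Bochner_Integration.integral_diff integrable_inner_left)
  also have "(\<integral>y. (indicator M y *\<^sub>R y) \<bullet> a \<partial>?\<nu>) = (LINT y:M|?\<nu>. y) \<bullet> a"
    unfolding set_lebesgue_integral_def using int by (intro integral_inner_left)
  also have "(\<integral>y. indicator M y *\<^sub>R l \<partial>?\<nu>) = l * m"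
    using M by (simp add: m_def borel_compact)
  finally have "(LINT y:M|?\<nu>. y) \<bullet> a \<le> l * m" using le by simp
  then show ?thesis using \<open>0 < m\<close>
    by (simp add: hausdorff_center_of_mass_def m_def[symmetric] field_simps)
qed

lemma center_of_mass_mem_closed_convex:
  fixes M :: "'a::euclidean_space set"
  assumes M: "compact M" "0 < emeasure (hausdorff_measure k) M" "emeasure (hausdorff_measure k) M < \<infinity>"
    and K: "closed K" "convex K" "M \<subseteq> K"
  shows "hausdorff_center_of_mass k M \<in> K"
proof (rule ccontr)
  let ?c = "hausdorff_center_of_mass k M"
  assume "?c \<notin> K"
  then obtain a b where ab: "a \<bullet> ?c < b" "\<And>x. x \<in> K \<Longrightarrow> b < a \<bullet> x"
    using separating_hyperplane_closed_point[OF K(2,1)] by blast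
  have "(\<integral>y. indicator M y *\<^sub>R (y \<bullet> (- a) - (- b)) \<partial>hausdorff_measure k) \<le> 0"
  proof (rule integral_nonpos)
    show "indicator M y *\<^sub>R (y \<bullet> (- a) - (- b)) \<le> (0::real)" for y
      using ab(2)[of y] K(3) by (auto simp: indicator_def inner_commute)
  qed
  then have "?c \<bullet> (- a) \<le> - b" by (rule center_of_mass_inner_le[OF M])
  then show False using ab(1) by (simp add: inner_commute)
qed

text \<open>
  Let \<open>g\<close> be the signed height above the hyperplane on \<open>M\<close>, and 0 off \<open>M\<close>. By invariance, twice
  its integral is the integral of \<open>g y + g (T y)\<close>. If both \<open>y\<close> and \<open>T y\<close> belong to \<open>M\<close> the two
  terms cancel. If only one does, that one is below the hyperplane, since the mirror image of
  a point of \<open>M\<close> above it is again in \<open>M\<close>. So the integrand is never positive.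
\<close>
lemma center_of_mass_le_of_folding:
  fixes M :: "'a::euclidean_space set"
  assumes M: "compact M" "0 < emeasure (hausdorff_measure k) M" "emeasure (hausdorff_measure k) M < \<infinity>"
    and \<omega>: "norm \<omega> = 1" and fold: "hyperplane_reflection l \<omega> ` upper_cap M l \<omega> \<subseteq> M"
  shows "hausdorff_center_of_mass k M \<bullet> \<omega> \<le> l"
proof (rule center_of_mass_inner_le[OF M])
  let ?\<nu> = "hausdorff_measure k :: 'a measure" and ?T = "hyperplane_reflection l \<omega>"
  define g where "g y = indicator M y *\<^sub>R (y \<bullet> \<omega> - l)" for y
  have g: "integrable ?\<nu> g"
    unfolding g_def by (intro integrable_indicator_continuous M continuous_intros)
  have distr: "distr ?\<nu> borel ?T = ?\<nu>"
    by (rule distr_hausdorff_measure_involution)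
      (simp_all add: hyperplane_reflection_isometry hyperplane_reflection_involution \<omega>)
  have T: "?T \<in> measurable ?\<nu> borel"
    unfolding measurable_hausdorff_measure hyperplane_reflection_def
    by (intro borel_measurable_continuous_onI continuous_intros)
  have "g \<in> borel_measurable borel" using g by (auto dest: borel_measurable_integrable)
  then have gT: "integrable ?\<nu> (\<lambda>y. g (?T y))" "(\<integral>y. g (?T y) \<partial>?\<nu>) = integral\<^sup>L ?\<nu> g"
    using g integrable_distr_eq[OF T, of g] integral_distr[OF T, of g] by (simp_all add: distr)
  have cap: "?T y \<in> M" if "y \<in> M" "l \<le> y \<bullet> \<omega>" for y
    using fold that by (auto simp: upper_cap_def)
  have "g y + g (?T y) \<le> 0" for y
  proof -
    have eq: "g y + g (?T y) = (indicator M y - indicator M (?T y)) * (y \<bullet> \<omega> - l)"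
      by (simp add: g_def inner_hyperplane_reflection[OF \<omega>] algebra_simps)
    show ?thesis
    proof (cases "l \<le> y \<bullet> \<omega>")
      case True
      then show ?thesis using cap[of y] unfolding eq by (auto simp: indicator_def)
    next
      case False
      then have "?T y \<in> M \<Longrightarrow> y \<in> M"
        using cap[of "?T y"] by (simp add: inner_hyperplane_reflection hyperplane_reflection_involution \<omega>)
      then show ?thesis using False unfolding eq by (auto simp: indicator_def)
    qed
  qed
  then have "(\<integral>y. g y + g (?T y) \<partial>?\<nu>) \<le> 0" by (intro integral_nonpos)
  then have "integral\<^sup>L ?\<nu> g \<le> 0" using g gT by simp
  then show "(\<integral>y. indicator M y *\<^sub>R (y \<bullet> \<omega> - l) \<partial>?\<nu>) \<le> 0" unfolding g_def .
qed

section \<open>The set of incenters\<close>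

text \<open>
  Otherwise the ball, which is connected, would contain points of \<open>K\<close> and points outside \<open>K\<close>, and so a
  point of the frontier closer to \<open>x\<close> than the frontier is.
\<close>
lemma cball_infdist_frontier_subset:
  fixes K :: "'a::euclidean_space set"
  assumes "closed K" "x \<in> K"
  shows "cball x (infdist x (frontier K)) \<subseteq> K"
proof -
  let ?s = "infdist x (frontier K)"
  have "ball x ?s \<subseteq> K"
  proof (rule ccontr)
    assume "\<not> ball x ?s \<subseteq> K"
    then obtain z where z: "z \<in> ball x ?s" "z \<notin> K" by blast
    then have "0 < ?s" using zero_le_dist[of x z] by (simp del: zero_le_dist)
    then have "x \<in> ball x ?s \<inter> K" using assms by simp
    then have "ball x ?s \<inter> frontier K \<noteq> {}"
      using z by (intro connected_Int_frontier connected_ball) blast+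
    then obtain p where p: "p \<in> frontier K" "dist x p < ?s" by auto
    then show False using infdist_le[OF p(1), of x] by simp
  qed
  then show ?thesis
  proof (cases "0 < ?s")
    case True
    then show ?thesis using closure_mono[OF \<open>ball x ?s \<subseteq> K\<close>] assms by simp
  next
    case False
    then show ?thesis using assms infdist_nonneg[of x "frontier K"] by (simp add: not_less)
  qed
qed

lemma le_infdist_frontier:
  fixes K :: "'a::euclidean_space set"
  assumes "cball x r \<subseteq> K" "frontier K \<noteq> {}"
  shows "r \<le> infdist x (frontier K)"
  unfolding infdist_notempty[OF assms(2)]
proof (rule cINF_greatest[OF assms(2)], rule ccontr)
  fix p assume p: "p \<in> frontier K" "\<not> r \<le> dist x p"
  then have "p \<in> ball x r" by simp
  also have "ball x r \<subseteq> interior K" using assms(1) ball_subset_cball by (intro interior_maximal) blast+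
  finally show False using p by (simp add: frontier_def)
qed

text \<open>
  The greatest element that defines the inradius exists: the distance to the frontier is continuous
  on the compact set \<open>K\<close>, hence attains its maximum, and this maximum is the inradius.
\<close>
lemma convex_body_inradius:
  fixes K :: "'a::euclidean_space set"
  assumes "convex_body K"
  shows "0 < inradius K" and "cball x s \<subseteq> K \<Longrightarrow> s \<le> inradius K"
proof -
  have K: "compact K" "interior K \<noteq> {}" using assms by (auto simp: convex_body_def)
  have fr: "frontier K \<noteq> {}"
    using K interior_subset[of K] by (auto simp: frontier_eq_empty dest: compact_imp_bounded)
  have "continuous_on K (\<lambda>x. infdist x (frontier K))" by (intro continuous_intros)
  then obtain x0 where x0: "x0 \<in> K" "\<And>x. x \<in> K \<Longrightarrow> infdist x (frontier K) \<le> infdist x0 (frontier K)"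
    using continuous_attains_sup[of K "\<lambda>x. infdist x (frontier K)"] K interior_subset[of K] by blast
  let ?r = "infdist x0 (frontier K)"
  have max: "s \<le> ?r" if "cball x s \<subseteq> K" for x s
  proof (cases "0 \<le> s")
    case True
    then have "x \<in> K" using that by auto
    then show ?thesis using le_infdist_frontier[OF that fr] x0(2) by force
  next
    case False
    then show ?thesis using infdist_nonneg[of x0 "frontier K"] by linarith
  qed
  obtain z e where "0 < e" "cball z e \<subseteq> K" using K(2) mem_interior_cball by blast
  then have "0 < ?r" using max by force
  then have "inradius K = ?r"
    unfolding inradius_def
    using max cball_infdist_frontier_subset[OF compact_imp_closed[OF K(1)] x0(1)]
    by (intro Greatest_equality) blast+
  then show "0 < inradius K" "cball x s \<subseteq> K \<Longrightarrow> s \<le> inradius K"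
    using \<open>0 < ?r\<close> max by auto
qed

lemma incenters_eq:
  assumes "convex_body K"
  shows "incenters K = {x. cball x (inradius K) \<subseteq> K}"
proof -
  have K: "compact K" "closed K" "interior K \<noteq> {}"
    using assms by (auto simp: convex_body_def compact_imp_closed)
  have fr: "frontier K \<noteq> {}"
    using K interior_subset[of K] by (auto simp: frontier_eq_empty dest: compact_imp_bounded)
  show ?thesis
  proof (intro equalityI subsetI)
    fix x assume "x \<in> incenters K"
    then have "x \<in> K" "infdist x (frontier K) = inradius K" by (auto simp: incenters_def)
    then show "x \<in> {x. cball x (inradius K) \<subseteq> K}"
      using cball_infdist_frontier_subset[OF K(2), of x] by simp
  next
    fix x assume "x \<in> {x. cball x (inradius K) \<subseteq> K}"
    then have x: "cball x (inradius K) \<subseteq> K" by simp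
    then have "x \<in> K" using convex_body_inradius(1)[OF assms] by auto
    moreover have "inradius K \<le> infdist x (frontier K)" using x fr by (rule le_infdist_frontier)
    moreover have "infdist x (frontier K) \<le> inradius K"
      using convex_body_inradius(2)[OF assms] cball_infdist_frontier_subset[OF K(2) \<open>x \<in> K\<close>] .
    ultimately show "x \<in> incenters K" by (simp add: incenters_def)
  qed
qed

text \<open>In this form convexity and closedness are inherited from \<open>K\<close>.\<close>
lemma incenters_eq_INT:
  assumes "convex_body K"
  shows "incenters K = (\<Inter>w\<in>cball 0 (inradius K). (\<lambda>x. x - w) ` K)"
proof -
  have "(cball x r \<subseteq> K) = (\<forall>w\<in>cball 0 r. x \<in> (\<lambda>x. x - w) ` K)" for x r
  proof -
    have *: "cball x r = (+) x ` cball 0 r" by simp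
    have "(cball x r \<subseteq> K) = (\<forall>w\<in>cball 0 r. x + w \<in> K)"
      unfolding * by (rule image_subset_iff)
    moreover have "(x \<in> (\<lambda>x. x - w) ` K) = (x + w \<in> K)" for w
      by (auto intro!: image_eqI[of _ _ "x + w"])
    ultimately show ?thesis by simp
  qed
  then show ?thesis by (auto simp: incenters_eq[OF assms])
qed

lemma convex_incenters: "convex_body K \<Longrightarrow> convex (incenters K)"
  by (simp add: incenters_eq_INT convex_body_def convex_INT convex_translation_subtract)

lemma compact_incenters:
  assumes "convex_body K"
  shows "compact (incenters K)"
proof -
  have "compact K" using assms by (simp add: convex_body_def)
  have "closed (incenters K)"
    unfolding incenters_eq_INT[OF assms]
    by (intro closed_INT ballI compact_imp_closed compact_translation_subtract \<open>compact K\<close>)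
  moreover have "bounded (incenters K)"
    using compact_imp_bounded[OF \<open>compact K\<close>] by (rule bounded_subset) (auto simp: incenters_def)
  ultimately show ?thesis by (simp add: compact_eq_bounded_closed)
qed

section \<open>Folding\<close>

text \<open>
  The least level in the definition of the maximal folding function exists. The admissible levels
  are bounded below, because reflecting a lowest point of \<open>K\<close> in a hyperplane below it leaves
  \<open>K\<close>, and they form a closed set: a point strictly above the limit hyperplane is eventually
  above the approximating ones, and a point on it is fixed.
\<close>
lemma folding_maximal_folding:
  assumes "compact K" "K \<noteq> {}" and \<omega>: "norm \<omega> = 1"
  shows "hyperplane_reflection (maximal_folding K \<omega>) \<omega> ` upper_cap K (maximal_folding K \<omega>) \<omega> \<subseteq> K"
proof -
  define L where "L = {l. hyperplane_reflection l \<omega> ` upper_cap K l \<omega> \<subseteq> K}"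
  have cont: "continuous_on K (\<lambda>x. x \<bullet> \<omega>)" by (intro continuous_intros)
  obtain p where p: "p \<in> K" "\<And>x. x \<in> K \<Longrightarrow> p \<bullet> \<omega> \<le> x \<bullet> \<omega>"
    using continuous_attains_inf[OF assms(1,2) cont] by blast
  obtain q where q: "q \<in> K" "\<And>x. x \<in> K \<Longrightarrow> x \<bullet> \<omega> \<le> q \<bullet> \<omega>"
    using continuous_attains_sup[OF assms(1,2) cont] by blast
  have "q \<bullet> \<omega> + 1 \<in> L"
    using q(2) by (force simp: L_def upper_cap_def)
  then have "L \<noteq> {}" by blast
  have lower: "p \<bullet> \<omega> \<le> l" if "l \<in> L" for l
  proof (rule ccontr)
    assume "\<not> p \<bullet> \<omega> \<le> l"
    then have "hyperplane_reflection l \<omega> p \<in> K"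
      using that p(1) by (auto simp: L_def upper_cap_def)
    then show False
      using p(2)[of "hyperplane_reflection l \<omega> p"] \<open>\<not> p \<bullet> \<omega> \<le> l\<close>
      by (simp add: inner_hyperplane_reflection[OF \<omega>])
  qed
  then have bdd: "bdd_below L" by (rule bdd_belowI)
  have "closed L"
    unfolding closed_sequential_limits
  proof (intro allI impI, elim conjE)
    fix s l assume s: "\<forall>n. s n \<in> L" and lim: "s \<longlonglongrightarrow> l"
    have "hyperplane_reflection l \<omega> x \<in> K" if x: "x \<in> K" "l \<le> x \<bullet> \<omega>" for x
    proof (cases "x \<bullet> \<omega> = l")
      case True
      then show ?thesis using x by (simp add: hyperplane_reflection_def)
    next
      case False
      then have "\<forall>\<^sub>F n in sequentially. s n < x \<bullet> \<omega>"
        using x lim by (intro order_tendstoD(2)) auto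
      then have "\<forall>\<^sub>F n in sequentially. hyperplane_reflection (s n) \<omega> x \<in> K"
        by (rule eventually_mono) (use s x in \<open>force simp: L_def upper_cap_def\<close>)
      moreover have "(\<lambda>n. hyperplane_reflection (s n) \<omega> x) \<longlonglongrightarrow> hyperplane_reflection l \<omega> x"
        unfolding hyperplane_reflection_def by (intro tendsto_intros lim)
      ultimately show ?thesis
        by (rule Lim_in_closed_set[OF compact_imp_closed[OF \<open>compact K\<close>] _ sequentially_bot])
    qed
    then show "l \<in> L" by (auto simp: L_def upper_cap_def)
  qed
  then have "Inf L \<in> L" using \<open>L \<noteq> {}\<close> bdd by (intro closed_contains_Inf)
  moreover have "maximal_folding K \<omega> = Inf L"
    unfolding maximal_folding_def using \<open>Inf L \<in> L\<close> bdd
    by (intro Least_equality) (auto simp: L_def intro: cInf_lower)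
  ultimately show ?thesis by (simp add: L_def)
qed

text \<open>
  A point \<open>y\<close> of the ball around the mirror image of \<open>x\<close> also lies in the ball around \<open>x\<close> if it is above
  the hyperplane. If it is below, its mirror image is a point of the ball around \<open>x\<close> above the
  hyperplane, and folding \<open>K\<close> brings it back to \<open>y\<close>.
\<close>
lemma incenters_folding:
  assumes K: "convex_body K" and \<omega>: "norm \<omega> = 1"
    and fold: "hyperplane_reflection l \<omega> ` upper_cap K l \<omega> \<subseteq> K"
  shows "hyperplane_reflection l \<omega> ` upper_cap (incenters K) l \<omega> \<subseteq> incenters K"
proof (rule image_subsetI)
  let ?T = "hyperplane_reflection l \<omega>"
  fix x assume "x \<in> upper_cap (incenters K) l \<omega>"
  then have x: "cball x (inradius K) \<subseteq> K" "l \<le> x \<bullet> \<omega>"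
    by (auto simp: upper_cap_def incenters_eq[OF K])
  have "y \<in> K" if y: "dist (?T x) y \<le> inradius K" for y
  proof (cases "l \<le> y \<bullet> \<omega>")
    case True
    have "0 \<le> 4 * (x \<bullet> \<omega> - l) * (y \<bullet> \<omega> - l)" using x True by simp
    then have "(dist y x)\<^sup>2 \<le> (dist y (?T x))\<^sup>2"
      unfolding dist_hyperplane_reflection[OF \<omega>] by linarith
    then have "dist y x \<le> dist y (?T x)" by (rule power2_le_imp_le) simp
    then show ?thesis using x(1) y by (auto simp: dist_commute subset_iff)
  next
    case False
    have "dist x (?T y) = dist (?T x) y"
      using hyperplane_reflection_isometry[OF \<omega>, of l x "?T y"]
      by (simp add: hyperplane_reflection_involution[OF \<omega>])
    then have "?T y \<in> K" using x(1) y by auto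
    moreover have "l \<le> ?T y \<bullet> \<omega>" using False by (simp add: inner_hyperplane_reflection[OF \<omega>])
    ultimately have "?T (?T y) \<in> K" using fold by (auto simp: upper_cap_def)
    then show ?thesis by (simp add: hyperplane_reflection_involution[OF \<omega>])
  qed
  then show "?T x \<in> incenters K" by (auto simp: incenters_eq[OF K])
qed

theorem proposition3p4:
  fixes K :: "'a::euclidean_space set" and k :: nat
  assumes "convex_body K"
    and "aff_dim (incenters K) = int k"
    and "k \<in> {1..DIM('a) - 1}"
  shows "hausdorff_center_of_mass k (incenters K) \<in> heart K"
proof -
  have K: "compact K" "convex K" using assms(1) by (auto simp: convex_body_def)
  have M: "compact (incenters K)" using assms(1) by (rule compact_incenters)
  have "K \<noteq> {}" using assms(1) interior_subset[of K] by (auto simp: convex_body_def)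
  have "emeasure (hausdorff_measure k) (incenters K) = hausdorff_outer_measure k (incenters K)"
    using M by (simp add: emeasure_hausdorff_measure borel_compact)
  then have pos: "0 < emeasure (hausdorff_measure k) (incenters K)"
    and fin: "emeasure (hausdorff_measure k) (incenters K) < \<infinity>"
    using hausdorff_outer_measure_pos[OF M convex_incenters[OF assms(1)] assms(2)]
      hausdorff_outer_measure_finite[OF compact_imp_bounded[OF M] assms(2)] by simp_all
  have "incenters K \<subseteq> K" by (auto simp: incenters_def)
  then have "hausdorff_center_of_mass k (incenters K) \<in> K"
    by (rule center_of_mass_mem_closed_convex[OF M pos fin compact_imp_closed[OF K(1)] K(2)])
  moreover have "hausdorff_center_of_mass k (incenters K) \<bullet> \<omega> \<le> maximal_folding K \<omega>"
    if "\<omega> \<in> sphere 0 1" for \<omega>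
  proof -
    have \<omega>: "norm \<omega> = 1" using that by simp
    show ?thesis
      by (rule center_of_mass_le_of_folding[OF M pos fin \<omega>
            incenters_folding[OF assms(1) \<omega> folding_maximal_folding[OF K(1) \<open>K \<noteq> {}\<close> \<omega>]]])
  qed
  ultimately show ?thesis by (simp add: heart_def)
qed

end
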